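(* Let $R\ge1$ be an integer, $k\ge2$ an even integer, and let $G=(V,E)$ be the two-dimensional (square-lattice) grid graph with periodic boundary conditions of size $k(2R^2+2R+1)\times k(2R^2+2R+1)$, with $n=k^2(2R^2+2R+1)^2$ vertices. Then there exists a $\mathbf Z_2$-symmetric range-$R$ circuit preparing a state $|\psi\rangle$ such that $$\langle\psi|H_{\mathrm{MaxCut}}|\psi\rangle=2n-\frac{2R+1}{2R^2+2R+1}\,n,$$ where $H_{\mathrm{MaxCut}}=\sum_{\{e_0,e_1\}\in E}\frac{1-Z_{e_0}Z_{e_1}}{2}$.
   Context: Qubits are labelled by the vertices of $G$. A circuit (unitary) $U$ has range $R$ with respect to $G$ if for every vertex $v$ and every single-qubit observable $\mathcal O_v$ supported on $v$, $U^\dagger\mathcal O_vU$ is supported on the set $B_G(v,R)$ of vertices at distance at most $R$ from $v$. A state $|\phi\rangle$ on $n$ qubits is $\mathbf Z_2$-symmetric if $X^{\otimes n}|\phi\rangle=|\phi\rangle$; a unitary $U$ is $\mathbf Z_2$-symmetric if $X^{\otimes n}UX^{\otimes n}=U$. A state is prepared by a $\mathbf Z_2$-symmetric range-$R$ circuit if it equals $U|\phi\rangle$ with $U$ a $\mathbf Z_2$-symmetric range-$R$ circuit and $|\phi\rangle$ a $\mathbf Z_2$-symmetric product state. *)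

theory Defs
  imports
    "HOL-Library.Countable_Set"
    "HOL-Library.Extended_Nat"
    Complex_Main
    "Jordan_Normal_Form.Schur_Decomposition"
begin

section \<open>Finite simple graphs\<close>

text \<open>An undirected simple graph is given by a vertex set and a set of two-element edges.\<close>

definition adj_rel :: "'v set set \<Rightarrow> ('v \<times> 'v) set" where
  "adj_rel E = {(u, v). {u, v} \<in> E}"

definition graph_dist :: "'v set set \<Rightarrow> 'v \<Rightarrow> 'v \<Rightarrow> enat" where
  "graph_dist E u v = (INF m \<in> {m. (u, v) \<in> adj_rel E ^^ m}. enat m)"

definition graph_ball :: "'v set \<Rightarrow> 'v set set \<Rightarrow> 'v \<Rightarrow> nat \<Rightarrow> 'v set" where
  "graph_ball V E v R = {w \<in> V. graph_dist E v w \<le> enat R}"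

definition torus_vertices :: "nat \<Rightarrow> (nat \<times> nat) set" where
  "torus_vertices L = {..<L} \<times> {..<L}"

definition torus_edges :: "nat \<Rightarrow> (nat \<times> nat) set set" where
  "torus_edges L =
     {{(a, b), (Suc a mod L, b)} | a b. a < L \<and> b < L} \<union>
     {{(a, b), (a, Suc b mod L)} | a b. a < L \<and> b < L}"

section \<open>Qubits labelled by the elements of a finite set\<close>

text \<open>
  The Hilbert space of qubits labelled by a finite set \<open>V\<close> has dimension \<open>2 ^ card V\<close>.
  Its computational basis is labelled by the subsets \<open>s\<close> of \<open>V\<close>: the qubit \<open>v\<close> is in state 1
  iff \<open>v \<in> s\<close>. The order in which \<open>config V\<close> enumerates these labels is fixed but irrelevant.
\<close>

definition qdim :: "'v set \<Rightarrow> nat" where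
  "qdim V = 2 ^ card V"

definition config :: "'v set \<Rightarrow> nat \<Rightarrow> 'v set" where
  "config V = from_nat_into (Pow V)"

definition qubit_val :: "'v set \<Rightarrow> 'v \<Rightarrow> nat" where
  "qubit_val s v = (if v \<in> s then 1 else 0)"

definition tensor_vec :: "'v set \<Rightarrow> ('v \<Rightarrow> complex vec) \<Rightarrow> complex vec" where
  "tensor_vec V f = vec (qdim V) (\<lambda>i. \<Prod>v\<in>V. f v $ qubit_val (config V i) v)"

definition tensor_mat :: "'v set \<Rightarrow> ('v \<Rightarrow> complex mat) \<Rightarrow> complex mat" where
  "tensor_mat V A = mat (qdim V) (qdim V)
     (\<lambda>(i, j). \<Prod>v\<in>V. A v $$ (qubit_val (config V i) v, qubit_val (config V j) v))"

definition pauli_x :: "complex mat" where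
  "pauli_x = mat_of_rows_list 2 [[0, 1], [1, 0]]"

definition pauli_z :: "complex mat" where
  "pauli_z = mat_of_rows_list 2 [[1, 0], [0, -1]]"

definition x_all :: "'v set \<Rightarrow> complex mat" where
  "x_all V = tensor_mat V (\<lambda>_. pauli_x)"

definition z_on :: "'v set \<Rightarrow> 'v set \<Rightarrow> complex mat" where
  "z_on V S = tensor_mat V (\<lambda>v. if v \<in> S then pauli_z else 1\<^sub>m 2)"

definition unitary_op :: "'v set \<Rightarrow> complex mat \<Rightarrow> bool" where
  "unitary_op V U \<longleftrightarrow> U \<in> carrier_mat (qdim V) (qdim V) \<and>
     mat_adjoint U * U = 1\<^sub>m (qdim V) \<and> U * mat_adjoint U = 1\<^sub>m (qdim V)"

definition observable :: "'v set \<Rightarrow> complex mat \<Rightarrow> bool" where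
  "observable V A \<longleftrightarrow> A \<in> carrier_mat (qdim V) (qdim V) \<and> mat_adjoint A = A"

text \<open>
  \<open>A\<close> is supported on \<open>S\<close> if it is the tensor product of some operator \<open>B\<close> on the qubits in \<open>S\<close>
  and the identity on the qubits in \<open>V - S\<close>.
\<close>

definition supported_on :: "'v set \<Rightarrow> 'v set \<Rightarrow> complex mat \<Rightarrow> bool" where
  "supported_on V S A \<longleftrightarrow> (\<exists>B :: 'v set \<Rightarrow> 'v set \<Rightarrow> complex.
     A = mat (qdim V) (qdim V) (\<lambda>(i, j).
       B (config V i \<inter> S) (config V j \<inter> S) *
       (if config V i - S = config V j - S then 1 else 0)))"

section \<open>Symmetric circuits of bounded range\<close>

definition has_range :: "'v set \<Rightarrow> 'v set set \<Rightarrow> nat \<Rightarrow> complex mat \<Rightarrow> bool" where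
  "has_range V E R U \<longleftrightarrow> (\<forall>v\<in>V. \<forall>A. observable V A \<and> supported_on V {v} A \<longrightarrow>
     supported_on V (graph_ball V E v R) (mat_adjoint U * A * U))"

definition z2_symmetric_state :: "'v set \<Rightarrow> complex vec \<Rightarrow> bool" where
  "z2_symmetric_state V \<phi> \<longleftrightarrow> x_all V *\<^sub>v \<phi> = \<phi>"

definition z2_symmetric_op :: "'v set \<Rightarrow> complex mat \<Rightarrow> bool" where
  "z2_symmetric_op V U \<longleftrightarrow> x_all V * U * x_all V = U"

definition product_state :: "'v set \<Rightarrow> complex vec \<Rightarrow> bool" where
  "product_state V \<phi> \<longleftrightarrow>
     (\<exists>f. (\<forall>v\<in>V. f v \<in> carrier_vec 2 \<and> f v \<bullet>c f v = 1) \<and> \<phi> = tensor_vec V f)"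

definition z2_range_prepared :: "'v set \<Rightarrow> 'v set set \<Rightarrow> nat \<Rightarrow> complex vec \<Rightarrow> bool" where
  "z2_range_prepared V E R \<psi> \<longleftrightarrow> (\<exists>U \<phi>.
     unitary_op V U \<and> z2_symmetric_op V U \<and> has_range V E R U \<and>
     product_state V \<phi> \<and> z2_symmetric_state V \<phi> \<and> \<psi> = U *\<^sub>v \<phi>)"

section \<open>The MaxCut Hamiltonian\<close>

text \<open>
  For an edge \<open>e = {u, v}\<close>, the operator \<open>z_on V e\<close> is the product of the Pauli Z operators on
  \<open>u\<close> and \<open>v\<close>; see \<open>z_on_edge\<close> below.
\<close>

definition maxcut_term :: "'v set \<Rightarrow> 'v set \<Rightarrow> complex mat" where
  "maxcut_term V e = (1 / 2) \<cdot>\<^sub>m (1\<^sub>m (qdim V) - z_on V e)"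

definition maxcut_hamiltonian :: "'v set \<Rightarrow> 'v set set \<Rightarrow> complex mat" where
  "maxcut_hamiltonian V E = mat (qdim V) (qdim V) (\<lambda>ij. \<Sum>e\<in>E. maxcut_term V e $$ ij)"

text \<open>The second argument of \<open>\<bullet>c\<close> is the conjugated one.\<close>

definition expectation_value :: "complex vec \<Rightarrow> complex mat \<Rightarrow> complex" where
  "expectation_value \<psi> A = (A *\<^sub>v \<psi>) \<bullet>c \<psi>"

lemma config_bij:
  assumes "finite V"
  shows "bij_betw (config V) {..<qdim V} (Pow V)"
  using bij_betw_from_nat_into_finite[of "Pow V"] assms
  by (simp add: config_def qdim_def card_Pow)

lemma z_on_dim [simp]: "dim_row (z_on V S) = qdim V" "dim_col (z_on V S) = qdim V"
  by (simp_all add: z_on_def tensor_mat_def)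

lemma z_factor:
  "(if b then pauli_z else 1\<^sub>m 2) $$ (qubit_val s v, qubit_val t v) =
    (if (v \<in> s) = (v \<in> t) then if b \<and> v \<in> s then - 1 else 1 else 0)"
  by (cases b; cases "v \<in> s"; cases "v \<in> t")
    (simp_all add: pauli_z_def mat_of_rows_list_def qubit_val_def)

lemma z_on_entry:
  assumes fin: "finite V" and i: "i < qdim V" and j: "j < qdim V"
  shows "z_on V S $$ (i, j) =
    (if i = j then (\<Prod>v\<in>V. if v \<in> S \<and> v \<in> config V i then - 1 else 1) else 0)"
proof -
  have *: "z_on V S $$ (i, j) = (\<Prod>v\<in>V. if (v \<in> config V i) = (v \<in> config V j)
      then if v \<in> S \<and> v \<in> config V i then - 1 else 1 else 0)"
    using i j by (simp add: z_on_def tensor_mat_def z_factor)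
  show ?thesis
  proof (cases "i = j")
    case True
    then show ?thesis using * by simp
  next
    case False
    have "config V i \<noteq> config V j"
      using bij_betw_imp_inj_on[OF config_bij[OF fin]] False i j
      by (metis inj_onD lessThan_iff)
    moreover have "config V i \<subseteq> V" "config V j \<subseteq> V"
      using bij_betwE[OF config_bij[OF fin]] i j by blast+
    ultimately obtain v where "v \<in> V" "(v \<in> config V i) \<noteq> (v \<in> config V j)" by blast
    then have "z_on V S $$ (i, j) = 0"
      unfolding * using fin by (intro prod_zero) auto
    then show ?thesis using False by simp
  qed
qed

lemma z_on_edge:
  assumes fin: "finite V" and "u \<noteq> v"
  shows "z_on V {u} * z_on V {v} = z_on V {u, v}"
proof (rule eq_matI)
  fix i j assume "i < dim_row (z_on V {u, v})" "j < dim_col (z_on V {u, v})"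
  then have ij: "i < qdim V" "j < qdim V" by simp_all
  have "(z_on V {u} * z_on V {v}) $$ (i, j) =
      (\<Sum>k = 0..<qdim V. z_on V {u} $$ (i, k) * z_on V {v} $$ (k, j))"
    using ij by (simp add: scalar_prod_def)
  also have "\<dots> = (\<Sum>k = 0..<qdim V.
      if k = i then z_on V {u} $$ (i, i) * z_on V {v} $$ (i, j) else 0)"
  proof (intro sum.cong refl)
    fix k assume "k \<in> {0..<qdim V}"
    then show "z_on V {u} $$ (i, k) * z_on V {v} $$ (k, j) =
        (if k = i then z_on V {u} $$ (i, i) * z_on V {v} $$ (i, j) else 0)"
      using ij z_on_entry[OF fin ij(1), of k "{u}"] by (cases "k = i") (simp, force)
  qed
  also have "\<dots> = z_on V {u} $$ (i, i) * z_on V {v} $$ (i, j)"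
    using ij by simp
  also have "\<dots> = z_on V {u, v} $$ (i, j)"
  proof -
    have "(\<Prod>w\<in>V. if w \<in> {u} \<and> w \<in> config V i then - 1 else 1 :: complex) *
        (\<Prod>w\<in>V. if w \<in> {v} \<and> w \<in> config V i then - 1 else 1) =
        (\<Prod>w\<in>V. if w \<in> {u, v} \<and> w \<in> config V i then - 1 else 1)"
      unfolding prod.distrib[symmetric] using assms(2) by (intro prod.cong) simp_all
    then show ?thesis
      unfolding z_on_entry[OF fin ij] z_on_entry[OF fin ij(1) ij(1)] by (cases "i = j") auto
  qed
  finally show "(z_on V {u} * z_on V {v}) $$ (i, j) = z_on V {u, v} $$ (i, j)" .
qed simp_all

end

theory Submission
  imports Defs "HOL-Library.Product_Plus"
begin

text \<open>
  The balls of radius \<open>R\<close> around the code words of the perfect Lee code tile the torus. On each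
  ball, starting with every qubit in the state +, every non-central qubit \<open>v\<close> is acted on by
  \<open>(X\<^sub>v \<plusminus> Z\<^sub>c Z\<^sub>v) / sqrt 2\<close>, where \<open>c\<close> is the center and the sign is the relative parity of \<open>v\<close>
  and \<open>c\<close>. This is a symmetric Hermitian unitary that maps + to the computational basis state of \<open>v\<close>
  aligned (up to the sign) with the one of \<open>c\<close>, so each ball ends up in a superposition of its two
  antiferromagnetic configurations. An observable at a non-central \<open>v\<close> spreads only to \<open>c\<close>, and one
  at \<open>c\<close> only to its ball, so the range is \<open>R\<close>. Edges inside a ball contribute 1 to the energy and
  edges between balls contribute 1/2; every ball has one outgoing edge to the right per row and one
  upwards per column, hence there are \<open>2 (2 R + 1)\<close> cross edges per ball.
\<close>

section \<open>Operators and states indexed by configurations\<close>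

text \<open>Kernels on pairs of configurations hide the arbitrary enumeration \<open>config\<close>:
  products become sums over \<open>Pow V\<close>, while supports and flips become set operations on
  the arguments.\<close>

definition op_of :: "'v set \<Rightarrow> ('v set \<Rightarrow> 'v set \<Rightarrow> complex) \<Rightarrow> complex mat" where
  "op_of V F = mat (qdim V) (qdim V) (\<lambda>(i, j). F (config V i) (config V j))"

definition state_of :: "'v set \<Rightarrow> ('v set \<Rightarrow> complex) \<Rightarrow> complex vec" where
  "state_of V f = vec (qdim V) (\<lambda>i. f (config V i))"

lemma op_of_carrier [simp]: "op_of V F \<in> carrier_mat (qdim V) (qdim V)"
  by (simp add: op_of_def)

lemma config_in_Pow: "finite V \<Longrightarrow> i < qdim V \<Longrightarrow> config V i \<in> Pow V"
  using bij_betwE[OF config_bij] by blast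

lemma config_subset: "finite V \<Longrightarrow> i < qdim V \<Longrightarrow> config V i \<subseteq> V"
  using config_in_Pow by blast

lemma config_eq_iff:
  "finite V \<Longrightarrow> i < qdim V \<Longrightarrow> j < qdim V \<Longrightarrow> config V i = config V j \<longleftrightarrow> i = j"
  using bij_betw_imp_inj_on[OF config_bij] by (metis inj_onD lessThan_iff)

lemma sum_config:
  assumes "finite V"
  shows "(\<Sum>i = 0..<qdim V. g (config V i)) = (\<Sum>s\<in>Pow V. g s)"
  using sum.reindex_bij_betw[OF config_bij[OF assms], of g] by (simp add: atLeast0LessThan)

lemma op_of_cong:
  assumes "finite V" and "\<And>s t. s \<subseteq> V \<Longrightarrow> t \<subseteq> V \<Longrightarrow> F s t = G s t"
  shows "op_of V F = op_of V G"
  by (rule eq_matI) (simp_all add: op_of_def assms config_subset)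

lemma one_op_of: "finite V \<Longrightarrow> 1\<^sub>m (qdim V) = op_of V (\<lambda>s t. of_bool (s = t))"
  by (rule eq_matI) (auto simp: op_of_def config_eq_iff)

lemma op_of_mult:
  assumes "finite V"
  shows "op_of V F * op_of V G = op_of V (\<lambda>s t. \<Sum>r\<in>Pow V. F s r * G r t)"
  by (rule eq_matI) (simp_all add: op_of_def scalar_prod_def sum_config[OF assms, symmetric])

lemma op_of_mult_vec:
  assumes "finite V"
  shows "op_of V F *\<^sub>v state_of V f = state_of V (\<lambda>s. \<Sum>r\<in>Pow V. F s r * f r)"
  by (rule eq_vecI)
    (simp_all add: op_of_def state_of_def scalar_prod_def sum_config[OF assms, symmetric])

lemma adjoint_op_of: "mat_adjoint (op_of V F) = op_of V (\<lambda>s t. cnj (F t s))"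
  by (rule eq_matI) (simp_all add: mat_adjoint_def op_of_def mat_of_rows_def)

lemma inner_state_of:
  assumes "finite V"
  shows "state_of V f \<bullet>c state_of V g = (\<Sum>s\<in>Pow V. f s * cnj (g s))"
  by (simp add: state_of_def scalar_prod_def sum_config[OF assms, symmetric])

lemma supported_on_op_of:
  "supported_on V S A \<longleftrightarrow>
    (\<exists>B. A = op_of V (\<lambda>s t. B (s \<inter> S) (t \<inter> S) * (if s - S = t - S then 1 else 0)))"
  by (simp add: supported_on_def op_of_def)

text \<open>The kernel on \<open>S'\<close> is the old \<open>B\<close> times a delta on
  \<open>S' - S\<close>, since agreement off \<open>S\<close> splits into agreement on
  \<open>S' - S\<close> and agreement off \<open>S'\<close>. This passes from a light cone to the
  ball containing it.\<close>

lemma supported_on_mono: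
  assumes "finite V" "supported_on V S A" "S \<subseteq> S'"
  shows "supported_on V S' A"
proof -
  obtain B where B: "A = op_of V (\<lambda>s t. B (s \<inter> S) (t \<inter> S) * (if s - S = t - S then 1 else 0))"
    using assms(2) by (auto simp: supported_on_op_of)
  have "A = op_of V (\<lambda>s t. (B ((s \<inter> S') \<inter> S) ((t \<inter> S') \<inter> S) *
      (if (s \<inter> S') - S = (t \<inter> S') - S then 1 else 0)) * (if s - S' = t - S' then 1 else 0))"
    unfolding B
  proof (rule op_of_cong[OF assms(1)])
    fix s t
    have 1: "x \<inter> S' \<inter> S = x \<inter> S" for x using assms(3) by blast
    have "s - S = t - S \<longleftrightarrow> s \<inter> S' - S = t \<inter> S' - S \<and> s - S' = t - S'"
      using assms(3) by blast
    then show "B (s \<inter> S) (t \<inter> S) * (if s - S = t - S then 1 else 0) =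
      B (s \<inter> S' \<inter> S) (t \<inter> S' \<inter> S) * (if s \<inter> S' - S = t \<inter> S' - S then 1 else 0) *
         (if s - S' = t - S' then 1 else 0)" unfolding 1 by simp
  qed
  then show ?thesis unfolding supported_on_op_of
    by (intro exI[of _ "\<lambda>s t. B (s \<inter> S) (t \<inter> S) * (if s - S = t - S then 1 else 0)"])
qed

lemma prod_of_bool:
  "finite A \<Longrightarrow> (\<Prod>x\<in>A. of_bool (P x) :: 'a :: comm_semiring_1) = of_bool (\<forall>x\<in>A. P x)"
  by (induction A rule: finite_induct) auto

text \<open>Distributivity: a configuration picks one of two terms at each qubit. The circuit
  identities below reduce to single-qubit sums through this law.\<close>

lemma sum_Pow_prod:
  fixes f :: "'v \<Rightarrow> bool \<Rightarrow> 'a :: comm_semiring_1"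
  assumes "finite V"
  shows "(\<Sum>s\<in>Pow V. \<Prod>x\<in>V. f x (x \<in> s)) = (\<Prod>x\<in>V. f x True + f x False)"
proof -
  have "(\<Prod>x\<in>V. f x (x \<in> s)) = (\<Prod>x\<in>s. f x True) * (\<Prod>x\<in>V - s. f x False)"
    if "s \<in> Pow V" for s
    using that prod.subset_diff[of s V "\<lambda>x. f x (x \<in> s)"] assms by (simp add: mult.commute)
  then show ?thesis using prod_add[OF assms, of "\<lambda>x. f x True" "\<lambda>x. f x False"] by simp
qed

lemma x_all_op_of:
  assumes "finite V"
  shows "x_all V = op_of V (\<lambda>s t. of_bool (t = V - s))"
proof -
  have "x_all V = op_of V (\<lambda>s t. \<Prod>v\<in>V. of_bool ((v \<in> s) \<noteq> (v \<in> t)))"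
    by (auto simp: x_all_def tensor_mat_def op_of_def qubit_val_def pauli_x_def
        mat_of_rows_list_def intro!: cong_mat prod.cong)
  also have "\<dots> = op_of V (\<lambda>s t. of_bool (t = V - s))"
    using assms by (intro op_of_cong) (auto simp: prod_of_bool split: split_of_bool)
  finally show ?thesis .
qed

lemma x_all_mult_vec:
  assumes "finite V"
  shows "x_all V *\<^sub>v state_of V f = state_of V (\<lambda>s. f (V - s))"
proof -
  have "(\<Sum>r\<in>Pow V. of_bool (r = V - s) * f r) = f (V - s)" for s
  proof -
    have "(\<Sum>r\<in>Pow V. of_bool (r = V - s) * f r) = (\<Sum>r\<in>Pow V. if r = V - s then f r else 0)"
      by (intro sum.cong) auto
    also have "\<dots> = f (V - s)" using assms by (subst sum.delta) auto
    finally show ?thesis .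
  qed
  then show ?thesis using assms by (simp add: x_all_op_of op_of_mult_vec)
qed

lemma x_all_conjugate:
  assumes "finite V"
  shows "x_all V * op_of V F * x_all V = op_of V (\<lambda>s t. F (V - s) (V - t))"
proof -
  have "x_all V * op_of V F = op_of V (\<lambda>s t. F (V - s) t)"
  proof -
    have "(\<Sum>r\<in>Pow V. of_bool (r = V - s) * F r t) = F (V - s) t" for s t
    proof -
      have "(\<Sum>r\<in>Pow V. of_bool (r = V - s) * F r t) = (\<Sum>r\<in>Pow V. if r = V - s then F r t else 0)"
        by (intro sum.cong) auto
      also have "\<dots> = F (V - s) t" using assms by (subst sum.delta) auto
      finally show ?thesis .
    qed
    then show ?thesis using assms by (simp add: x_all_op_of op_of_mult)
  qed
  moreover have "op_of V G * x_all V = op_of V (\<lambda>s t. G s (V - t))" for G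
  proof -
    have "(\<Sum>r\<in>Pow V. G s r * of_bool (t = V - r)) = G s (V - t)" if "t \<subseteq> V" for s t
    proof -
      have "(\<Sum>r\<in>Pow V. G s r * of_bool (t = V - r)) = (\<Sum>r\<in>Pow V. if r = V - t then G s r else 0)"
        using that by (intro sum.cong) auto
      also have "\<dots> = G s (V - t)" using assms by (subst sum.delta) auto
      finally show ?thesis .
    qed
    then show ?thesis unfolding x_all_op_of[OF assms] op_of_mult[OF assms]
      by (intro op_of_cong assms) auto
  qed
  ultimately show ?thesis by simp
qed

section \<open>The cat state circuit of a clustering\<close>

text \<open>\<open>c v\<close> is the center of the cluster of \<open>v\<close>, and \<open>\<sigma>\<close> is a two-colouring that
  selects the signs of the correlations.\<close>

locale clustering =
  fixes V :: "'v set" and c :: "'v \<Rightarrow> 'v" and \<sigma> :: "'v \<Rightarrow> bool"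
  assumes finite_V: "finite V"
    and center_in: "v \<in> V \<Longrightarrow> c v \<in> V"
    and center_idem: "v \<in> V \<Longrightarrow> c (c v) = c v"
begin

definition h :: complex where "h = complex_of_real (1 / sqrt 2)"

text \<open>The matrix entry between \<open>a\<close> and \<open>b\<close> of the gate at \<open>v\<close> when its control \<open>c v\<close> has value \<open>z\<close>.
  The controls are diagonal, so the entries of the circuit are products over the qubits.\<close>

definition gate :: "'v \<Rightarrow> bool \<Rightarrow> bool \<Rightarrow> bool \<Rightarrow> complex" where
  "gate v a b z = (if c v = v then of_bool (a = b)
     else h * (if a \<noteq> b then 1 else if (a = \<sigma> v) = (z = \<sigma> (c v)) then 1 else - 1))"

definition circ :: "'v set \<Rightarrow> 'v set \<Rightarrow> complex" where
  "circ s t = (\<Prod>v\<in>V. gate v (v \<in> s) (v \<in> t) (c v \<in> s))"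

lemma h_square: "h * h = 1 / 2"
proof -
  have "(1 / sqrt 2) * (1 / sqrt 2) = (1 / 2 :: real)" by simp
  then show ?thesis unfolding h_def of_real_mult[symmetric] by simp
qed

lemma cnj_h [simp]: "cnj h = h"
  by (simp add: h_def)

lemma cnj_gate [simp]: "cnj (gate v a b z) = gate v a b z"
  by (simp add: gate_def)

lemma cnj_circ [simp]: "cnj (circ s t) = circ s t"
  by (simp add: circ_def)

lemma gate_commute: "gate v a b z = gate v b a z"
  by (auto simp: gate_def)

text \<open>The sign only compares target and control relative to the colouring, so flipping both
  together leaves it alone. The symmetry of the whole circuit is this identity taken qubit by
  qubit.\<close>

lemma gate_not: "gate v (\<not> a) (\<not> b) (\<not> z) = gate v a b z"
  by (cases a; cases b; cases z) (simp_all add: gate_def)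

text \<open>For a fixed control value a non-central gate is (X + Z) / sqrt 2 or (X - Z) / sqrt 2,
  and it squares to the identity because X and Z anticommute.\<close>

lemma gate_involution:
  "gate v a True z * gate v True b z + gate v a False z * gate v False b z = of_bool (a = b)"
  by (cases a; cases b) (auto simp: gate_def h_square)

text \<open>Every control is a center, and the circuit acts on centers as the identity in the
  computational basis. So either \<open>s\<close> and \<open>t\<close> agree on all centers, or both
  products contain a vanishing factor.\<close>

lemma circ_target_control:
  "circ s t = (\<Prod>v\<in>V. gate v (v \<in> s) (v \<in> t) (c v \<in> t))"
proof (cases "\<forall>v\<in>V. c v = v \<longrightarrow> (v \<in> s \<longleftrightarrow> v \<in> t)")
  case True
  then show ?thesis unfolding circ_def
    by (intro prod.cong refl) (simp add: center_in center_idem)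
next
  case False
  then obtain y where "y \<in> V" "c y = y" "(y \<in> s) \<noteq> (y \<in> t)" by blast
  have "circ s t = 0" unfolding circ_def
    using \<open>y \<in> V\<close> \<open>c y = y\<close> \<open>(y \<in> s) \<noteq> (y \<in> t)\<close> finite_V
    by (intro prod_zero bexI[of _ y]) (auto simp: gate_def)
  moreover have "(\<Prod>v\<in>V. gate v (v \<in> s) (v \<in> t) (c v \<in> t)) = 0"
    using \<open>y \<in> V\<close> \<open>c y = y\<close> \<open>(y \<in> s) \<noteq> (y \<in> t)\<close> finite_V
    by (intro prod_zero bexI[of _ y]) (auto simp: gate_def)
  ultimately show ?thesis by simp
qed

lemma circ_commute: "circ s t = circ t s"
  by (subst circ_target_control) (simp add: circ_def gate_commute)

text \<open>The two products of gates are taken with their controls in \<open>s\<close> and in \<open>t\<close>, so that the sum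
  over the intermediate configuration factorizes over the qubits.\<close>

lemma circ_sandwich:
  "(\<Sum>r'\<in>Pow V. (\<Sum>r\<in>Pow V. circ s r * (\<Prod>x\<in>V. a x (x \<in> r) (x \<in> r'))) * circ r' t) =
   (\<Prod>x\<in>V. \<Sum>q\<in>UNIV. (\<Sum>p\<in>UNIV. gate x (x \<in> s) p (c x \<in> s) * a x p q) * gate x q (x \<in> t) (c x \<in> t))"
proof -
  have 1: "(\<Sum>r\<in>Pow V. circ s r * (\<Prod>x\<in>V. a x (x \<in> r) (x \<in> r'))) =
    (\<Prod>x\<in>V. \<Sum>p\<in>UNIV. gate x (x \<in> s) p (c x \<in> s) * a x p (x \<in> r'))" for r'
    using sum_Pow_prod[OF finite_V, of "\<lambda>x p. gate x (x \<in> s) p (c x \<in> s) * a x p (x \<in> r')"]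
    by (simp add: circ_def prod.distrib UNIV_bool add.commute)
  show ?thesis unfolding 1
    using sum_Pow_prod[OF finite_V, of "\<lambda>x q. (\<Sum>p\<in>UNIV. gate x (x \<in> s) p (c x \<in> s) * a x p q)
      * gate x q (x \<in> t) (c x \<in> t)"]
    by (simp add: circ_target_control[of _ t] prod.distrib UNIV_bool add.commute)
qed

text \<open>With the controls of the left factor read in \<open>s\<close> and those of the right
  factor read in \<open>t\<close>, the sum factorizes. If the centers agree,
  \<open>gate_involution\<close> evaluates each factor; otherwise the factor at a differing center
  is 0.\<close>

lemma circ_involution:
  assumes "s \<subseteq> V" "t \<subseteq> V"
  shows "(\<Sum>r\<in>Pow V. circ s r * circ r t) = of_bool (s = t)"
proof -
  let ?f = "\<lambda>x. gate x (x \<in> s) True (c x \<in> s) * gate x True (x \<in> t) (c x \<in> t)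
     + gate x (x \<in> s) False (c x \<in> s) * gate x False (x \<in> t) (c x \<in> t)"
  have "(\<Sum>r\<in>Pow V. circ s r * circ r t) = (\<Prod>x\<in>V. ?f x)"
    using sum_Pow_prod[OF finite_V,
        of "\<lambda>x q. gate x (x \<in> s) q (c x \<in> s) * gate x q (x \<in> t) (c x \<in> t)"]
    by (simp add: circ_target_control[of _ t] circ_def[of s] prod.distrib)
  also have "\<dots> = of_bool (s = t)"
  proof (cases "\<forall>v\<in>V. c v = v \<longrightarrow> (v \<in> s \<longleftrightarrow> v \<in> t)")
    case True
    then have "(\<Prod>x\<in>V. ?f x) = (\<Prod>x\<in>V. of_bool ((x \<in> s) = (x \<in> t)))"
      by (intro prod.cong refl) (simp add: center_in center_idem gate_involution)
    also have "\<dots> = of_bool (s = t)"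
      using assms by (auto simp: prod_of_bool finite_V split: split_of_bool)
    finally show ?thesis .
  next
    case False
    then obtain y where y: "y \<in> V" "c y = y" "(y \<in> s) \<noteq> (y \<in> t)" by blast
    then have "(\<Prod>x\<in>V. ?f x) = 0"
      using finite_V by (intro prod_zero bexI[of _ y]) (auto simp: gate_def)
    then show ?thesis using y by auto
  qed
  finally show ?thesis .
qed

lemma adjoint_circ: "mat_adjoint (op_of V circ) = op_of V circ"
  unfolding adjoint_op_of by (intro op_of_cong finite_V) (simp add: circ_commute)

lemma circ_unitary: "unitary_op V (op_of V circ)"
proof -
  have "op_of V circ * op_of V circ = 1\<^sub>m (qdim V)"
    unfolding op_of_mult[OF finite_V] one_op_of[OF finite_V]
    by (intro op_of_cong finite_V circ_involution)
  then show ?thesis unfolding unitary_op_def adjoint_circ by simp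
qed

lemma circ_symmetric: "z2_symmetric_op V (op_of V circ)"
  unfolding z2_symmetric_op_def x_all_conjugate[OF finite_V]
proof (intro op_of_cong finite_V)
  fix s t assume "s \<subseteq> V" "t \<subseteq> V"
  show "circ (V - s) (V - t) = circ s t"
    unfolding circ_def
    by (intro prod.cong refl) (simp add: gate_not center_in)
qed

text \<open>The qubits sharing a gate with \<open>v\<close>. For a non-central \<open>v\<close> the
  last set is empty, because centers are their own centers.\<close>

definition light_cone :: "'v \<Rightarrow> 'v set" where
  "light_cone v = insert v (insert (c v) {x \<in> V. c x = v})"

text \<open>The conjugated operator is again a product of single-qubit factors \<open>g\<close>.
  Away from the light cone the two gates at \<open>x\<close> meet with only the identity between
  them and cancel, as long as their common control has the same value on both sides.\<close>

lemma circ_light_cone: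
  assumes v: "v \<in> V" and A: "supported_on V {v} A"
  shows "supported_on V (light_cone v) (mat_adjoint (op_of V circ) * A * op_of V circ)"
proof -
  let ?S = "light_cone v"
  obtain B where B: "A = op_of V (\<lambda>s t. B (s \<inter> {v}) (t \<inter> {v}) * (if s - {v} = t - {v} then 1 else 0))"
    using A by (auto simp: supported_on_op_of)
  \<comment> \<open>The single-qubit matrices whose tensor product is \<open>A\<close>: the operator
    \<open>B\<close> at \<open>v\<close> and the identity elsewhere.\<close>
  define a where "a x p q = (if x = v then B (if p then {v} else {}) (if q then {v} else {})
    else of_bool (p = q))" for x p q
  have A_prod: "A = op_of V (\<lambda>s t. \<Prod>x\<in>V. a x (x \<in> s) (x \<in> t))"
    unfolding B
  proof (intro op_of_cong finite_V)
    fix s t assume st: "s \<subseteq> V" "t \<subseteq> V"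
    have "(\<Prod>x\<in>V. a x (x \<in> s) (x \<in> t)) = a v (v \<in> s) (v \<in> t) * (\<Prod>x\<in>V-{v}. a x (x \<in> s) (x \<in> t))"
      using finite_V v by (rule prod.remove)
    also have "(\<Prod>x\<in>V-{v}. a x (x \<in> s) (x \<in> t)) = (\<Prod>x\<in>V-{v}. of_bool ((x \<in> s) = (x \<in> t)))"
      by (intro prod.cong) (auto simp: a_def)
    also have "\<dots> = (if s - {v} = t - {v} then 1 else 0)"
      using st finite_V by (auto simp: prod_of_bool)
    also have "a v (v \<in> s) (v \<in> t) = B (s \<inter> {v}) (t \<inter> {v})"
      by (simp add: a_def)
    finally show "B (s \<inter> {v}) (t \<inter> {v}) * (if s - {v} = t - {v} then 1 else 0) =
      (\<Prod>x\<in>V. a x (x \<in> s) (x \<in> t))" by simp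
  qed
  define g where "g x s t = (\<Sum>q\<in>UNIV. (\<Sum>p\<in>UNIV. gate x (x \<in> s) p (c x \<in> s) * a x p q)
    * gate x q (x \<in> t) (c x \<in> t))" for x s t
  have UAU: "mat_adjoint (op_of V circ) * A * op_of V circ = op_of V (\<lambda>s t. \<Prod>x\<in>V. g x s t)"
    unfolding adjoint_circ A_prod op_of_mult[OF finite_V] circ_sandwich g_def ..
  have g_center: "g y s t = 0" if "y \<noteq> v" "c y = y" "(y \<in> s) \<noteq> (y \<in> t)" for y s t
    using that by (auto simp: g_def a_def gate_def UNIV_bool)
  have g_other: "g x s t = of_bool ((x \<in> s) = (x \<in> t))"
    if "x \<noteq> v" "(c x \<in> s) = (c x \<in> t)" for x s t
    using that gate_involution[of x "x \<in> s" "c x \<in> t" "x \<in> t"]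
    by (simp add: g_def a_def UNIV_bool add.commute)
  have S: "?S \<subseteq> V" using v by (auto simp: light_cone_def center_in)
  \<comment> \<open>The light cone contains the controls of its own gates, so its factors depend
    only on the restrictions of \<open>s\<close> and \<open>t\<close> to it.\<close>
  have S_closed: "c x \<in> ?S" if "x \<in> ?S" for x
    using that v by (auto simp: light_cone_def center_idem)
  have not_S: "x \<noteq> v \<and> c x \<noteq> v" if "x \<in> V" "x \<notin> ?S" for x
    using that by (auto simp: light_cone_def)
  have "op_of V (\<lambda>s t. \<Prod>x\<in>V. g x s t) =
    op_of V (\<lambda>s t. (\<Prod>x\<in>?S. g x (s \<inter> ?S) (t \<inter> ?S)) * (if s - ?S = t - ?S then 1 else 0))"
  proof (intro op_of_cong finite_V)
    fix s t assume st: "s \<subseteq> V" "t \<subseteq> V"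
    have gS: "(\<Prod>x\<in>?S. g x (s \<inter> ?S) (t \<inter> ?S)) = (\<Prod>x\<in>?S. g x s t)"
      by (intro prod.cong refl) (simp add: g_def S_closed)
    have split: "(\<Prod>x\<in>V. g x s t) = (\<Prod>x\<in>V - ?S. g x s t) * (\<Prod>x\<in>?S. g x s t)"
      using finite_V S by (rule prod.subset_diff[rotated])
    \<comment> \<open>If a center other than \<open>v\<close> differs, both sides are 0: the right
      side through the delta when that center lies outside the light cone, and through its factor
      when it lies inside.\<close>
    show "(\<Prod>x\<in>V. g x s t) = (\<Prod>x\<in>?S. g x (s \<inter> ?S) (t \<inter> ?S)) * (if s - ?S = t - ?S then 1 else 0)"
    proof (cases "\<forall>y\<in>V. y \<noteq> v \<longrightarrow> c y = y \<longrightarrow> (y \<in> s) = (y \<in> t)")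
      case True
      have "(\<Prod>x\<in>V - ?S. g x s t) = (\<Prod>x\<in>V - ?S. of_bool ((x \<in> s) = (x \<in> t)))"
        using True not_S by (intro prod.cong refl g_other) (auto simp: center_in center_idem)
      also have "\<dots> = (if s - ?S = t - ?S then 1 else 0)"
        using st finite_V by (auto simp: prod_of_bool)
      finally show ?thesis unfolding gS split by simp
    next
      case False
      then obtain y where y: "y \<in> V" "y \<noteq> v" "c y = y" "(y \<in> s) \<noteq> (y \<in> t)" by blast
      have 0: "(\<Prod>x\<in>V. g x s t) = 0"
        using y finite_V by (intro prod_zero bexI[of _ y] g_center) auto
      show ?thesis
      proof (cases "s - ?S = t - ?S")
        case True
        then have "y \<in> ?S" using y by blast
        then have "(\<Prod>x\<in>?S. g x s t) = 0"
          using y finite_subset[OF S finite_V] by (intro prod_zero bexI[of _ y] g_center) auto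
        then show ?thesis using 0 gS by simp
      qed (use 0 in simp)
    qed
  qed
  then show ?thesis unfolding UAU supported_on_op_of
    by (intro exI[of _ "\<lambda>s t. \<Prod>x\<in>?S. g x s t"])
qed

lemma circ_has_range:
  assumes "\<And>v. v \<in> V \<Longrightarrow> light_cone v \<subseteq> graph_ball V E v R"
  shows "has_range V E R (op_of V circ)"
  using assms circ_light_cone supported_on_mono[OF finite_V] unfolding has_range_def by blast

section \<open>The input product state and the resulting cat state\<close>

definition plus_state :: "complex vec" where "plus_state = state_of V (\<lambda>s. \<Prod>v\<in>V. h)"

lemma plus_product: "product_state V plus_state"
  unfolding product_state_def
proof (intro exI[of _ "\<lambda>_. vec 2 (\<lambda>_. h)"] conjI ballI)
  show "plus_state = tensor_vec V (\<lambda>_. vec 2 (\<lambda>_. h))"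
    by (rule eq_vecI) (auto simp: plus_state_def state_of_def tensor_vec_def qubit_val_def)
qed (simp_all add: scalar_prod_def h_square)

lemma plus_symmetric: "z2_symmetric_state V plus_state"
  by (simp add: z2_symmetric_state_def plus_state_def x_all_mult_vec finite_V)

definition cat_state :: "'v set \<Rightarrow> complex" where
  "cat_state s = (\<Sum>t\<in>Pow V. circ s t * (\<Prod>v\<in>V. h))"

lemma circ_plus: "op_of V circ *\<^sub>v plus_state = state_of V cat_state"
  unfolding plus_state_def op_of_mult_vec[OF finite_V] cat_state_def ..

text \<open>A row of a non-central gate sums to \<open>2 * h\<close> or 0, so times the amplitude
  \<open>h\<close> it gives 1 or 0: the qubit is tied to its center. Only the centers keep a factor
  \<open>h\<close>.\<close>

lemma cat_eq:
  "cat_state s = (\<Prod>v\<in>V. if c v = v then h else of_bool ((v \<in> s \<longleftrightarrow> \<sigma> v) \<longleftrightarrow> (c v \<in> s \<longleftrightarrow> \<sigma> (c v))))"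
proof -
  have "cat_state s = (\<Prod>v\<in>V. gate v (v \<in> s) True (c v \<in> s) * h + gate v (v \<in> s) False (c v \<in> s) * h)"
    using sum_Pow_prod[OF finite_V, of "\<lambda>v p. gate v (v \<in> s) p (c v \<in> s) * h"]
    unfolding cat_state_def circ_def prod.distrib by simp
  also have "\<dots> = (\<Prod>v\<in>V. if c v = v then h
      else of_bool ((v \<in> s \<longleftrightarrow> \<sigma> v) \<longleftrightarrow> (c v \<in> s \<longleftrightarrow> \<sigma> (c v))))"
    by (intro prod.cong refl) (auto simp: gate_def h_square mult.assoc[symmetric])
  finally show ?thesis .
qed

lemma cnj_cat [simp]: "cnj (cat_state s) = cat_state s"
  by (simp add: cat_state_def)

text \<open>Summing over the middle configuration first collapses the two circuits by
  \<open>circ_involution\<close>, leaving the norm of the product state,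
  \<open>2 ^ card V * (h * h) ^ card V\<close>.\<close>

lemma cat_norm: "(\<Sum>s\<in>Pow V. cat_state s * cat_state s) = 1"
proof -
  let ?H = "\<Prod>v\<in>V. h"
  have "(\<Sum>s\<in>Pow V. cat_state s * cat_state s) =
    (\<Sum>s\<in>Pow V. \<Sum>t\<in>Pow V. \<Sum>t'\<in>Pow V. ?H * ?H * (circ t s * circ s t'))"
    by (simp add: cat_state_def sum_product circ_commute[of _ "_ :: 'v set"] mult_ac)
  also have "\<dots> = (\<Sum>t\<in>Pow V. \<Sum>t'\<in>Pow V. \<Sum>s\<in>Pow V. ?H * ?H * (circ t s * circ s t'))"
    by (rule trans[OF sum.swap], rule sum.cong[OF refl], rule sum.swap)
  also have "\<dots> = (\<Sum>t\<in>Pow V. \<Sum>t'\<in>Pow V. if t' = t then ?H * ?H else 0)"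
    by (intro sum.cong refl) (auto simp: sum_distrib_left[symmetric] circ_involution)
  also have "\<dots> = (\<Sum>t\<in>Pow V. ?H * ?H)"
    using finite_V by (intro sum.cong refl) (simp add: sum.delta)
  also have "\<dots> = 2 ^ card V * (h * h) ^ card V"
    using finite_V by (simp add: card_Pow power_mult_distrib)
  also have "\<dots> = 1" by (simp add: h_square power_mult_distrib[symmetric])
  finally show ?thesis .
qed

section \<open>Eigenvalues of Pauli Z, correlations and the energy\<close>

definition spin :: "'v \<Rightarrow> 'v set \<Rightarrow> complex" where
  "spin u s = (if u \<in> s then - 1 else 1)"

lemma cat_nonzero:
  assumes "cat_state s \<noteq> 0" "v \<in> V"
  shows "(v \<in> s \<longleftrightarrow> \<sigma> v) \<longleftrightarrow> (c v \<in> s \<longleftrightarrow> \<sigma> (c v))"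
proof (rule ccontr)
  assume *: "\<not> ?thesis"
  then have "cat_state s = 0"
    unfolding cat_eq using finite_V assms(2) by (intro prod_zero bexI[of _ v]) auto
  then show False using assms(1) by contradiction
qed

text \<open>On every configuration of nonzero amplitude both qubits are tied to the same center, so
  different colours force opposite spins. The weighted summand is thus minus the weight,
  pointwise.\<close>

lemma corr_inner:
  assumes "u \<in> V" "v \<in> V" "\<sigma> u \<noteq> \<sigma> v" "c u = c v"
  shows "(\<Sum>s\<in>Pow V. spin u s * spin v s * (cat_state s * cat_state s)) = - 1"
proof -
  have "spin u s * spin v s * (cat_state s * cat_state s) = - (cat_state s * cat_state s)" for s
  proof (cases "cat_state s = 0")
    case False
    then show ?thesis using cat_nonzero[OF False assms(1)] cat_nonzero[OF False assms(2)] assms(3,4)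
      by (auto simp: spin_def)
  qed simp
  then show ?thesis by (simp add: sum_negf cat_norm)
qed

text \<open>Flipping the whole cluster of \<open>u\<close> preserves the weights and reverses the sign.\<close>

lemma corr_cross:
  assumes "u \<in> V" "v \<in> V" "c u \<noteq> c v"
  shows "(\<Sum>s\<in>Pow V. spin u s * spin v s * (cat_state s * cat_state s)) = 0"
proof -
  define T where "T = {x \<in> V. c x = c u}"
  define flip where "flip s = (s - T) \<union> (T - s)" for s
  let ?f = "\<lambda>s. spin u s * spin v s * (cat_state s * cat_state s)"
  have mem: "x \<in> flip s \<longleftrightarrow> (if c x = c u then x \<notin> s else x \<in> s)" if "x \<in> V" for x s
    using that by (auto simp: flip_def T_def)
  have "cat_state (flip s) = cat_state s" for s
    unfolding cat_eq by (intro prod.cong refl) (auto simp: mem center_in center_idem)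
  moreover have "spin u (flip s) = - spin u s" for s
    by (simp add: spin_def mem assms)
  moreover have "spin v (flip s) = spin v s" for s
    using assms(3) by (simp add: spin_def mem assms(1,2))
  ultimately have neg: "?f (flip s) = - ?f s" for s by simp
  have "flip (flip s) = s" for s by (auto simp: flip_def)
  moreover have "flip s \<in> Pow V" if "s \<in> Pow V" for s using that by (auto simp: flip_def T_def)
  ultimately have "bij_betw flip (Pow V) (Pow V)"
    by (intro bij_betw_byWitness[where f' = flip]) auto
  then have "(\<Sum>s\<in>Pow V. ?f (flip s)) = (\<Sum>s\<in>Pow V. ?f s)"
    by (rule sum.reindex_bij_betw)
  then show ?thesis unfolding neg by (simp add: sum_negf)
qed

text \<open>Products of Pauli Z are diagonal, and the factors at qubits outside an edge are 1, so
  only the spins of its endpoints remain.\<close>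

lemma maxcut_op_of:
  assumes "\<And>e. e \<in> E \<Longrightarrow> \<exists>u\<in>V. \<exists>v\<in>V. u \<noteq> v \<and> e = {u, v}"
  shows "maxcut_hamiltonian V E = op_of V (\<lambda>s t. of_bool (s = t) *
     (\<Sum>e\<in>E. (1 - (\<Prod>v\<in>e. spin v s)) / 2))"
proof -
  have zz: "(\<Prod>w\<in>V. if w \<in> e \<and> w \<in> s then - 1 else 1) = (\<Prod>w\<in>e. spin w s)" if "e \<in> E" for e s
  proof -
    have "e \<subseteq> V" using assms[OF that] by auto
    have "(\<Prod>w\<in>V. if w \<in> e \<and> w \<in> s then - 1 else 1) = (\<Prod>w\<in>V. if w \<in> e then spin w s else 1)"
      by (intro prod.cong) (auto simp: spin_def)
    also have "\<dots> = (\<Prod>w\<in>e. spin w s)"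
      using \<open>e \<subseteq> V\<close> finite_V by (simp add: prod.If_cases Int_absorb1)
    finally show ?thesis .
  qed
  show ?thesis
  proof (rule eq_matI)
    fix i j
    assume "i < dim_row (op_of V (\<lambda>s t. of_bool (s = t) * (\<Sum>e\<in>E. (1 - (\<Prod>v\<in>e. spin v s)) / 2)))"
      "j < dim_col (op_of V (\<lambda>s t. of_bool (s = t) * (\<Sum>e\<in>E. (1 - (\<Prod>v\<in>e. spin v s)) / 2)))"
    then have ij: "i < qdim V" "j < qdim V" by (simp_all add: op_of_def)
    have "maxcut_term V e $$ (i, j) =
        of_bool (i = j) * ((1 - (\<Prod>v\<in>e. spin v (config V i))) / 2)" if "e \<in> E" for e
      using ij by (simp add: maxcut_term_def z_on_entry[OF finite_V ij] zz[OF that])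
    then have "(\<Sum>e\<in>E. maxcut_term V e $$ (i, j)) =
        (\<Sum>e\<in>E. of_bool (i = j) * ((1 - (\<Prod>v\<in>e. spin v (config V i))) / 2))"
      by (intro sum.cong refl)
    then show "maxcut_hamiltonian V E $$ (i, j) = op_of V (\<lambda>s t. of_bool (s = t) *
        (\<Sum>e\<in>E. (1 - (\<Prod>v\<in>e. spin v s)) / 2)) $$ (i, j)"
      using ij by (simp add: maxcut_hamiltonian_def op_of_def config_eq_iff finite_V sum_distrib_left)
  qed (simp_all add: maxcut_hamiltonian_def op_of_def)
qed

text \<open>The \<open>is_singleton\<close> test says that an edge stays inside one cluster without
  ordering its endpoints. By \<open>corr_inner\<close> and \<open>corr_cross\<close> such an edge
  contributes 1 and any other edge 1/2.\<close>

lemma expectation_cat: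
  assumes E: "\<And>e. e \<in> E \<Longrightarrow> \<exists>u\<in>V. \<exists>v\<in>V. e = {u, v} \<and> \<sigma> u \<noteq> \<sigma> v"
    and fin: "finite E"
  shows "expectation_value (state_of V cat_state) (maxcut_hamiltonian V E) =
    of_nat (card E) - of_nat (card {e \<in> E. \<not> is_singleton (c ` e)}) / 2"
proof -
  have ex: "\<exists>u\<in>V. \<exists>v\<in>V. u \<noteq> v \<and> e = {u, v}" if "e \<in> E" for e
  proof -
    obtain u v where "u \<in> V" "v \<in> V" "e = {u, v}" "\<sigma> u \<noteq> \<sigma> v" using E[OF \<open>e \<in> E\<close>] by blast
    then show ?thesis by (intro bexI[of _ u] bexI[of _ v]) auto
  qed
  have corr: "(\<Sum>s\<in>Pow V. (\<Prod>v\<in>e. spin v s) * (cat_state s * cat_state s)) =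
    of_bool (\<not> is_singleton (c ` e)) - 1" if "e \<in> E" for e
  proof -
    obtain u v where uv: "u \<in> V" "v \<in> V" "e = {u, v}" "\<sigma> u \<noteq> \<sigma> v" using E[OF \<open>e \<in> E\<close>] by blast
    then have "u \<noteq> v" by blast
    then have "(\<Sum>s\<in>Pow V. (\<Prod>v\<in>e. spin v s) * (cat_state s * cat_state s)) =
      (\<Sum>s\<in>Pow V. spin u s * spin v s * (cat_state s * cat_state s))" by (simp add: uv(3))
    moreover have "is_singleton (c ` e) \<longleftrightarrow> c u = c v"
      by (auto simp: is_singleton_def uv(3))
    ultimately show ?thesis
      using corr_inner[of u v] corr_cross[of u v] uv by (cases "c u = c v") auto
  qed
  have ham: "maxcut_hamiltonian V E = op_of V (\<lambda>s t. of_bool (s = t) *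
     (\<Sum>e\<in>E. (1 - (\<Prod>v\<in>e. spin v s)) / 2))"
    by (rule maxcut_op_of) (rule ex)
  have "expectation_value (state_of V cat_state) (maxcut_hamiltonian V E) =
    (\<Sum>s\<in>Pow V. (\<Sum>r\<in>Pow V. of_bool (s = r) * (\<Sum>e\<in>E. (1 - (\<Prod>v\<in>e. spin v s)) / 2) * cat_state r) * cat_state s)"
    unfolding expectation_value_def ham op_of_mult_vec[OF finite_V]
      inner_state_of[OF finite_V] by simp
  also have "\<dots> = (\<Sum>s\<in>Pow V. (\<Sum>e\<in>E. (1 - (\<Prod>v\<in>e. spin v s)) / 2) * cat_state s * cat_state s)"
  proof (intro sum.cong refl)
    fix s assume s: "s \<in> Pow V"
    have "(\<Sum>r\<in>Pow V. of_bool (s = r) * k * cat_state r) = k * cat_state s" for k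
    proof -
      have "(\<Sum>r\<in>Pow V. of_bool (s = r) * k * cat_state r) = (\<Sum>r\<in>Pow V. if r = s then k * cat_state r else 0)"
        by (intro sum.cong) auto
      then show ?thesis using s finite_V by (simp add: sum.delta)
    qed
    then show "(\<Sum>r\<in>Pow V. of_bool (s = r) * (\<Sum>e\<in>E. (1 - (\<Prod>v\<in>e. spin v s)) / 2) * cat_state r) * cat_state s =
      (\<Sum>e\<in>E. (1 - (\<Prod>v\<in>e. spin v s)) / 2) * cat_state s * cat_state s" by simp
  qed
  also have "\<dots> = (\<Sum>e\<in>E. \<Sum>s\<in>Pow V. (1 - (\<Prod>v\<in>e. spin v s)) / 2 * (cat_state s * cat_state s))"
    unfolding sum_distrib_right mult.assoc by (rule sum.swap)
  also have "\<dots> = (\<Sum>e\<in>E. 1 - of_bool (\<not> is_singleton (c ` e)) / 2)"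
  proof (intro sum.cong refl)
    fix e assume e: "e \<in> E"
    have "(\<Sum>s\<in>Pow V. (1 - (\<Prod>v\<in>e. spin v s)) / 2 * (cat_state s * cat_state s)) =
      ((\<Sum>s\<in>Pow V. cat_state s * cat_state s) - (\<Sum>s\<in>Pow V. (\<Prod>v\<in>e. spin v s) * (cat_state s * cat_state s))) / 2"
      unfolding sum_subtractf[symmetric] sum_divide_distrib
      by (intro sum.cong refl) (simp add: algebra_simps)
    then show "(\<Sum>s\<in>Pow V. (1 - (\<Prod>v\<in>e. spin v s)) / 2 * (cat_state s * cat_state s)) =
      1 - of_bool (\<not> is_singleton (c ` e)) / 2"
      unfolding cat_norm corr[OF e] by (simp add: field_simps)
  qed
  also have "\<dots> = of_nat (card E) - of_nat (card {e \<in> E. \<not> is_singleton (c ` e)}) / 2"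
    using fin by (simp add: sum_subtractf sum_divide_distrib[symmetric] sum.If_cases of_bool_def Int_def)
  finally show ?thesis .
qed

end

section \<open>The perfect Lee code on the torus\<close>

definition lee_ball :: "nat \<Rightarrow> (int \<times> int) set" where
  "lee_ball R = {(x, y). \<bar>x\<bar> + \<bar>y\<bar> \<le> int R}"

definition lee_size :: "nat \<Rightarrow> nat" where
  "lee_size R = 2 * R\<^sup>2 + 2 * R + 1"

text \<open>The code words are the points whose syndrome is divisible by \<open>lee_size R\<close>.
  Covering and packing below show that the ball around the origin represents each residue exactly
  once.\<close>

definition syndrome :: "nat \<Rightarrow> int \<times> int \<Rightarrow> int" where
  "syndrome R = (\<lambda>(x, y). x + (2 * int R + 1) * y)"

lemma syndrome_add: "syndrome R (p + q) = syndrome R p + syndrome R q"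
  by (simp add: syndrome_def split_beta algebra_simps)

lemma syndrome_diff: "syndrome R (p - q) = syndrome R p - syndrome R q"
  by (simp add: syndrome_def split_beta algebra_simps)

lemma int_lee_size: "int (lee_size R) = 2 * (int R * int R) + 2 * int R + 1"
  by (simp add: lee_size_def power2_eq_square)

lemma lee_size_pos: "0 < lee_size R"
  by (simp add: lee_size_def)

text \<open>With \<open>t = (2 R + 1) y + r\<close>, the residues with \<open>y \<le> r \<le> 2 R - y\<close> come from the row \<open>y\<close> of the
  ball; the gaps between these intervals are filled by the rows with negative index.\<close>

lemma lee_covering: "\<exists>d\<in>lee_ball R. int (lee_size R) dvd m - syndrome R d"
proof -
  \<comment> \<open>Shifting by \<open>R\<close> makes row 0 of the ball occupy the residues from 0
    to 2 R, so that \<open>r\<close> is the first coordinate plus \<open>R\<close> in the rows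
    \<open>y\<close> with non-negative index.\<close>
  define t where "t = (m + int R) mod int (lee_size R)"
  define y where "y = t div (2 * int R + 1)"
  define r where "r = t mod (2 * int R + 1)"
  have t: "t = (2 * int R + 1) * y + r" by (simp add: y_def r_def)
  have r: "0 \<le> r" "r \<le> 2 * int R"
    using pos_mod_bound[of "2 * int R + 1" t] by (simp_all add: r_def)
  have s: "int (lee_size R) > 0" using lee_size_pos by simp
  have t0: "0 \<le> t" "t < int (lee_size R)" using s by (simp_all add: t_def)
  have y0: "0 \<le> y" using t0(1) by (simp add: y_def pos_imp_zdiv_nonneg_iff)
  have yR: "y \<le> int R"
  proof (rule ccontr)
    assume "\<not> y \<le> int R"
    then have "(2 * int R + 1) * (int R + 1) \<le> (2 * int R + 1) * y" by (intro mult_left_mono) auto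
    then show False using t0(2) t r(1) by (simp add: int_lee_size algebra_simps)
  qed
  have t_cong: "int (lee_size R) dvd m + int R - t" by (simp add: t_def mod_eq_dvd_iff[symmetric])
  have *: ?thesis if d: "d \<in> lee_ball R" "syndrome R d = t - int R - j * int (lee_size R)" for d j
  proof (rule bexI[OF _ d(1)])
    have "m - syndrome R d = (m + int R - t) + j * int (lee_size R)" using d(2) by simp
    then show "int (lee_size R) dvd m - syndrome R d"
      using dvd_add[OF t_cong dvd_triv_right[of "int (lee_size R)" j]] by metis
  qed
  consider "y \<le> r" "r \<le> 2 * int R - y" | "r < y" | "2 * int R - y < r" by linarith
  then show ?thesis
  proof cases
    case 1
    show ?thesis
      by (rule *[of "(r - int R, y)" 0]) (use 1 y0 in \<open>auto simp: lee_ball_def syndrome_def t\<close>)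
  next
    case 2
    \<comment> \<open>Both gap cases use a syndrome lower by one full period
      \<open>lee_size R\<close>, since (2 R + 1) (R + 1) = \<open>lee_size R\<close> + R.\<close>
    show ?thesis
      by (rule *[of "(r, y - 1 - int R)" 1])
        (use 2 r yR in \<open>auto simp: lee_ball_def syndrome_def t int_lee_size algebra_simps\<close>)
  next
    case 3
    show ?thesis
      by (rule *[of "(r - 2 * int R - 1, y - int R)" 1])
        (use 3 r yR in \<open>auto simp: lee_ball_def syndrome_def t int_lee_size algebra_simps\<close>)
  qed
qed

text \<open>Here (x, y) is a difference of two ball points. Equality would give x + y >= 2 R + 1
  when y <= R, and y - x >= 2 R + 1 otherwise, both beyond length 2 R.\<close>

lemma lee_packing_aux:
  fixes R x y :: int
  assumes "\<bar>x\<bar> + \<bar>y\<bar> \<le> 2 * R" "R \<ge> 0"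
  shows "x + (2 * R + 1) * y \<noteq> 2 * (R * R) + 2 * R + 1"
proof
  assume eq: "x + (2 * R + 1) * y = 2 * (R * R) + 2 * R + 1"
  show False
  proof (cases "y \<le> R")
    case True
    then have "R * y \<le> R * R" using assms(2) by (rule mult_left_mono)
    then have "x + y \<ge> 2 * R + 1" using eq by (simp add: algebra_simps)
    then show False using assms(1) by linarith
  next
    case False
    then have "(2 * R + 2) * (R + 1) \<le> (2 * R + 2) * y" using assms(2) by (intro mult_left_mono) auto
    then have "y - x \<ge> 2 * R + 1" using eq by (simp add: algebra_simps)
    then show False using assms(1) by linarith
  qed
qed

text \<open>The difference has syndrome \<open>q\<close> times \<open>lee_size R\<close>, and the
  crude bound (2 R + 1) 2 R < 2 \<open>lee_size R\<close> leaves only q = -1, 0, 1. For q = 0 a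
  nonzero \<open>y\<close> would make \<open>x\<close> too long; the other two values are
  \<open>lee_packing_aux\<close> up to sign.\<close>

lemma lee_packing:
  assumes "d \<in> lee_ball R" "d' \<in> lee_ball R"
    and dvd: "int (lee_size R) dvd syndrome R d - syndrome R d'"
  shows "d = d'"
proof -
  define x where "x = fst d - fst d'"
  define y where "y = snd d - snd d'"
  let ?s = "int (lee_size R)"
  let ?z = "x + (2 * int R + 1) * y"
  have xy: "\<bar>x\<bar> + \<bar>y\<bar> \<le> 2 * int R"
    using assms(1,2) by (auto simp: lee_ball_def x_def y_def)
  have z: "syndrome R d - syndrome R d' = ?z"
    by (simp add: syndrome_def x_def y_def split_beta algebra_simps)
  then obtain q where q: "?z = ?s * q" using dvd by (auto elim: dvdE)
  have "\<bar>?z\<bar> \<le> \<bar>x\<bar> + (2 * int R + 1) * \<bar>y\<bar>"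
    using abs_triangle_ineq[of x "(2 * int R + 1) * y"] by (simp add: abs_mult)
  also have "\<dots> \<le> (2 * int R + 1) * (\<bar>x\<bar> + \<bar>y\<bar>)" by (simp add: algebra_simps)
  also have "\<dots> \<le> (2 * int R + 1) * (2 * int R)" using xy by (intro mult_left_mono) auto
  also have "\<dots> < ?s * 2" by (simp add: int_lee_size algebra_simps)
  finally have "?s * \<bar>q\<bar> < ?s * 2" unfolding q by (simp add: abs_mult)
  then have "\<bar>q\<bar> < 2" using lee_size_pos[of R] by simp
  then consider "q = 0" | "q = 1" | "q = - 1" by linarith
  then have "x = 0 \<and> y = 0"
  proof cases
    case 1
    then have "x = - ((2 * int R + 1) * y)" using q
      by (simp add: eq_neg_iff_add_eq_0)
    then have abs_x: "\<bar>x\<bar> = (2 * int R + 1) * \<bar>y\<bar>" by (simp add: abs_mult)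
    have "\<not> \<bar>y\<bar> \<ge> 1"
    proof
      assume "\<bar>y\<bar> \<ge> 1"
      then have "(2 * int R + 1) * 1 \<le> \<bar>x\<bar>" unfolding abs_x by (intro mult_left_mono) auto
      then have "2 * int R + 1 \<le> \<bar>x\<bar>" by (simp only: mult_1_right)
      then show False using xy abs_ge_zero[of y] by linarith
    qed
    then have "y = 0" by linarith
    then show ?thesis using \<open>x = - ((2 * int R + 1) * y)\<close> by simp
  next
    case 2
    then show ?thesis using lee_packing_aux[OF xy] q by (simp add: int_lee_size)
  next
    case 3
    have "- x + (2 * int R + 1) * - y = - ?z" by (simp add: algebra_simps)
    also have "\<dots> = 2 * (int R * int R) + 2 * int R + 1" unfolding q 3 int_lee_size by simp
    finally show ?thesis using lee_packing_aux[of "- x" "- y" "int R"] xy by simp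
  qed
  then show ?thesis by (simp add: x_def y_def prod_eq_iff)
qed

text \<open>The position of \<open>p\<close> relative to the code word whose ball contains it.
  Covering gives existence and packing uniqueness.\<close>

definition offset :: "nat \<Rightarrow> int \<times> int \<Rightarrow> int \<times> int" where
  "offset R p = (SOME d. d \<in> lee_ball R \<and> int (lee_size R) dvd syndrome R p - syndrome R d)"

lemma offset: "offset R p \<in> lee_ball R" "int (lee_size R) dvd syndrome R p - syndrome R (offset R p)"
  using someI_ex[of "\<lambda>d. d \<in> lee_ball R \<and> int (lee_size R) dvd syndrome R p - syndrome R d"]
    lee_covering[of R "syndrome R p"] unfolding offset_def by blast+

lemma offset_unique:
  assumes "d \<in> lee_ball R" "int (lee_size R) dvd syndrome R p - syndrome R d"
  shows "offset R p = d"
proof (rule lee_packing[OF offset(1) assms(1)])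
  have "syndrome R (offset R p) - syndrome R d =
    (syndrome R p - syndrome R d) - (syndrome R p - syndrome R (offset R p))" by simp
  then show "int (lee_size R) dvd syndrome R (offset R p) - syndrome R d"
    using dvd_diff[OF assms(2) offset(2)[of R p]] by simp
qed

section \<open>The torus as a quotient of the integer plane, and walks on it\<close>

definition wrap :: "nat \<Rightarrow> int \<times> int \<Rightarrow> nat \<times> nat" where
  "wrap L = (\<lambda>(x, y). (nat (x mod int L), nat (y mod int L)))"

definition unwrap :: "nat \<times> nat \<Rightarrow> int \<times> int" where
  "unwrap = (\<lambda>(a, b). (int a, int b))"

lemma wrap_unwrap: "p \<in> torus_vertices L \<Longrightarrow> wrap L (unwrap p) = p"
  by (auto simp: wrap_def unwrap_def torus_vertices_def)

lemma wrap_in: "L > 0 \<Longrightarrow> wrap L q \<in> torus_vertices L"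
  by (auto simp: wrap_def torus_vertices_def split_beta nat_less_iff)

lemma wrap_eq_iff:
  assumes "L > 0"
  shows "wrap L p = wrap L q \<longleftrightarrow> int L dvd fst p - fst q \<and> int L dvd snd p - snd q"
  using assms by (auto simp: wrap_def split_beta mod_eq_dvd_iff[symmetric] eq_nat_nat_iff)

lemma unwrap_wrap_dvd:
  assumes "L > 0"
  shows "int L dvd fst (unwrap (wrap L q)) - fst q" "int L dvd snd (unwrap (wrap L q)) - snd q"
  using assms by (auto simp: wrap_def unwrap_def split_beta mod_eq_dvd_iff[symmetric])

lemma wrap_unwrap_wrap_diff:
  assumes "L > 0"
  shows "wrap L (unwrap (wrap L q) - d) = wrap L (q - d)"
  using unwrap_wrap_dvd[OF assms, of q] assms by (simp add: wrap_eq_iff algebra_simps)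

lemma adj_rel_sym: "(u, v) \<in> adj_rel E \<Longrightarrow> (v, u) \<in> adj_rel E"
  by (simp add: adj_rel_def insert_commute)

lemma adj_rel_relpow_sym: "(u, v) \<in> adj_rel E ^^ m \<Longrightarrow> (v, u) \<in> adj_rel E ^^ m"
proof (induction m arbitrary: v)
  case (Suc m)
  obtain w where w: "(u, w) \<in> adj_rel E ^^ m" "(w, v) \<in> adj_rel E"
    using Suc.prems by (rule relpow_Suc_E)
  show ?case by (rule relpow_Suc_I2[OF adj_rel_sym[OF w(2)] Suc.IH[OF w(1)]])
qed simp

lemma graph_dist_le: "(u, v) \<in> adj_rel E ^^ m \<Longrightarrow> graph_dist E u v \<le> enat m"
  unfolding graph_dist_def by (intro INF_lower) simp

lemma nat_mod_Suc:
  assumes "L > 0"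
  shows "nat ((x + 1) mod int L) = Suc (nat (x mod int L)) mod L"
proof -
  have "int (Suc (nat (x mod int L)) mod L) = (x mod int L + 1) mod int L"
    using assms by (simp add: zmod_int add.commute)
  also have "\<dots> = (x + 1) mod int L" by (simp add: mod_add_left_eq)
  finally show ?thesis by simp
qed

lemma torus_adj:
  assumes "L > 0"
  shows "(wrap L (x, y), wrap L (x + 1, y)) \<in> adj_rel (torus_edges L)"
    and "(wrap L (x, y), wrap L (x, y + 1)) \<in> adj_rel (torus_edges L)"
  using assms wrap_in[OF assms, of "(x, y)"]
  unfolding adj_rel_def torus_edges_def
  by (auto simp: wrap_def nat_mod_Suc torus_vertices_def)

lemma torus_walk_nat:
  assumes "L > 0"
  shows "(wrap L (x, y), wrap L (x + int i, y)) \<in> adj_rel (torus_edges L) ^^ i"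
    and "(wrap L (x, y), wrap L (x, y + int i)) \<in> adj_rel (torus_edges L) ^^ i"
proof (induction i)
  case (Suc i)
  {
    case 1
    have "wrap L (x + int (Suc i), y) = wrap L ((x + int i) + 1, y)" by (simp add: algebra_simps)
    then show ?case using Suc(1) torus_adj(1)[OF assms, of "x + int i" y] by (auto intro: relpow_Suc_I)
  next
    case 2
    have "wrap L (x, y + int (Suc i)) = wrap L (x, (y + int i) + 1)" by (simp add: algebra_simps)
    then show ?case using Suc(2) torus_adj(2)[OF assms, of x "y + int i"] by (auto intro: relpow_Suc_I)
  }
qed simp_all

text \<open>Walk horizontally first and then vertically; a negative displacement is a reversed
  positive walk.\<close>

lemma torus_walk:
  assumes "L > 0"
  shows "(wrap L p, wrap L (p + d)) \<in> adj_rel (torus_edges L) ^^ (nat \<bar>fst d\<bar> + nat \<bar>snd d\<bar>)"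
proof -
  obtain x y dx dy where [simp]: "p = (x, y)" "d = (dx, dy)" by fastforce
  have 1: "(wrap L (x, y), wrap L (x + dx, y)) \<in> adj_rel (torus_edges L) ^^ nat \<bar>dx\<bar>"
    using torus_walk_nat(1)[OF assms, of x y "nat \<bar>dx\<bar>"]
      adj_rel_relpow_sym[OF torus_walk_nat(1)[OF assms, of "x + dx" y "nat \<bar>dx\<bar>"]]
    by (cases "dx \<ge> 0") simp_all
  have 2: "(wrap L (x + dx, y), wrap L (x + dx, y + dy)) \<in> adj_rel (torus_edges L) ^^ nat \<bar>dy\<bar>"
    using torus_walk_nat(2)[OF assms, of "x + dx" y "nat \<bar>dy\<bar>"]
      adj_rel_relpow_sym[OF torus_walk_nat(2)[OF assms, of "x + dx" "y + dy" "nat \<bar>dy\<bar>"]]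
    by (cases "dy \<ge> 0") simp_all
  show ?thesis using 1 2 by (auto simp: relpow_add)
qed

section \<open>Counting residues in an interval of whole periods\<close>

lemma card_residue_class:
  fixes r s k :: nat
  assumes "r < s"
  shows "card {a. a < k * s \<and> a mod s = r} = k"
proof -
  have "{a. a < k * s \<and> a mod s = r} = (\<lambda>i. i * s + r) ` {..<k}"
  proof (intro equalityI subsetI)
    fix a assume a: "a \<in> {a. a < k * s \<and> a mod s = r}"
    then have "a div s < k" by (simp add: less_mult_imp_div_less)
    moreover have "a = a div s * s + r" using a by auto
    ultimately show "a \<in> (\<lambda>i. i * s + r) ` {..<k}" by blast
  next
    fix a assume "a \<in> (\<lambda>i. i * s + r) ` {..<k}"
    then obtain i where i: "i < k" "a = i * s + r" by blast
    have "(i + 1) * s \<le> k * s" using i by (intro mult_le_mono1) simp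
    then show "a \<in> {a. a < k * s \<and> a mod s = r}" using i assms by simp
  qed
  moreover have "inj_on (\<lambda>i. i * s + r) {..<k}" using assms by (intro inj_onI) simp
  ultimately show ?thesis by (simp add: card_image)
qed

lemma card_dvd_class:
  fixes k s :: nat and m :: int
  assumes "s > 0"
  shows "card {a. a < k * s \<and> int s dvd int a - m} = k"
proof -
  have "int s dvd int a - m \<longleftrightarrow> a mod s = nat (m mod int s)" for a
  proof -
    have "int s dvd int a - m \<longleftrightarrow> int (a mod s) = m mod int s"
      by (simp add: mod_eq_dvd_iff[symmetric] zmod_int)
    also have "\<dots> \<longleftrightarrow> a mod s = nat (m mod int s)"
      using assms by (auto simp: nat_eq_iff)
    finally show ?thesis .
  qed
  then show ?thesis using card_residue_class[of "nat (m mod int s)" s k] assms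
    by (simp add: nat_less_iff)
qed

section \<open>Clusters of the torus and their edges\<close>

text \<open>As \<open>lee_size R\<close> divides \<open>L\<close>, the code is well defined on the
  torus. Evenness of \<open>k\<close> makes \<open>L\<close> even, so the checkerboard colouring
  survives the wrap-around, and \<open>k \<ge> 2\<close> makes \<open>L\<close> exceed the width of
  a ball.\<close>

locale lee_torus =
  fixes R k L :: nat
  assumes R_pos: "R \<ge> 1" and k_ge: "k \<ge> 2" and k_even: "even k"
    and L_def: "L = k * lee_size R"
begin

lemma L_large: "2 * R + 1 < L" "3 \<le> L" "0 < L"
proof -
  have "2 * lee_size R \<le> L" using k_ge by (simp add: L_def)
  then show 1: "2 * R + 1 < L" by (simp add: lee_size_def)
  then show "3 \<le> L" "0 < L" using R_pos by auto
qed

lemma L_even: "even L"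
  using k_even by (simp add: L_def)

abbreviation "V \<equiv> torus_vertices L"

definition center :: "nat \<times> nat \<Rightarrow> nat \<times> nat" where
  "center p = wrap L (unwrap p - offset R (unwrap p))"

definition parity :: "nat \<times> nat \<Rightarrow> bool" where
  "parity = (\<lambda>(a, b). even (a + b))"

lemma syndrome_wrap: "int (lee_size R) dvd syndrome R (unwrap (wrap L q)) - syndrome R q"
proof -
  let ?d = "unwrap (wrap L q) - q"
  have "int (lee_size R) dvd int L" by (simp add: L_def)
  then have "int (lee_size R) dvd fst ?d" "int (lee_size R) dvd snd ?d"
    using unwrap_wrap_dvd[OF L_large(3), of q] by (auto intro: dvd_trans)
  then have "int (lee_size R) dvd syndrome R ?d"
    by (simp add: syndrome_def split_beta)
  then show ?thesis by (simp add: syndrome_diff)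
qed

lemma offset_wrap:
  assumes "d \<in> lee_ball R" "int (lee_size R) dvd syndrome R q - syndrome R d"
  shows "offset R (unwrap (wrap L q)) = d"
proof (rule offset_unique[OF assms(1)])
  show "int (lee_size R) dvd syndrome R (unwrap (wrap L q)) - syndrome R d"
    using dvd_add[OF syndrome_wrap[of q] assms(2)] by simp
qed

lemma center_wrap: "center (wrap L q) = wrap L (q - offset R (unwrap (wrap L q)))"
  by (simp add: center_def wrap_unwrap_wrap_diff L_large)

lemma center_in: "center p \<in> V"
  by (simp add: center_def wrap_in L_large)

text \<open>Subtracting the offset leaves a code word, also after wrapping, and the offset of a code
  word is the origin.\<close>

lemma center_idem: "center (center p) = center p"
proof -
  have zero: "syndrome R (0, 0) = 0" by (simp add: syndrome_def)
  have "offset R (unwrap (center p)) = (0, 0)"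
    unfolding center_def
    by (rule offset_wrap) (simp_all add: lee_ball_def syndrome_diff zero offset(2))
  then show ?thesis
    using center_wrap[of "unwrap p - offset R (unwrap p)"]
    by (simp add: center_def[symmetric] zero_prod_def[symmetric])
qed

text \<open>A step inside the ball moves the offset along with the point, by uniqueness of offsets.
  Conversely, a common center makes the two candidate offsets congruent modulo \<open>L\<close>, and
  they are too close together to differ.\<close>

lemma center_step:
  assumes "p \<in> V" and e: "\<bar>fst e\<bar> + \<bar>snd e\<bar> \<le> 1"
  shows "center (wrap L (unwrap p + e)) = center p \<longleftrightarrow> offset R (unwrap p) + e \<in> lee_ball R"
proof
  let ?d = "offset R (unwrap p)"
  assume *: "?d + e \<in> lee_ball R"
  have "offset R (unwrap (wrap L (unwrap p + e))) = ?d + e"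
    by (rule offset_wrap[OF *]) (simp add: syndrome_add offset(2))
  then show "center (wrap L (unwrap p + e)) = center p"
    by (simp add: center_wrap) (simp add: center_def)
next
  let ?d = "offset R (unwrap p)"
  define d' where "d' = offset R (unwrap (wrap L (unwrap p + e)))"
  assume "center (wrap L (unwrap p + e)) = center p"
  then have "wrap L (unwrap p + e - d') = wrap L (unwrap p - ?d)"
    unfolding center_wrap d'_def[symmetric] by (simp add: center_def)
  then have dvd: "int L dvd fst (?d + e - d')" "int L dvd snd (?d + e - d')"
    using wrap_eq_iff[OF L_large(3)] by (simp_all add: algebra_simps)
  have "?d \<in> lee_ball R" "d' \<in> lee_ball R" by (simp_all add: d'_def offset(1))
  \<comment> \<open>Two ball offsets and one unit step add up to at most 2 R + 1 in each
    coordinate.\<close>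
  then have "\<bar>fst (?d + e - d')\<bar> < int L" "\<bar>snd (?d + e - d')\<bar> < int L"
    using e L_large(1) by (auto simp: lee_ball_def split_beta)
  then have "?d + e - d' = 0"
    using dvd zdvd_imp_le[of "int L" "\<bar>fst (?d + e - d')\<bar>"] zdvd_imp_le[of "int L" "\<bar>snd (?d + e - d')\<bar>"]
    by (auto simp: prod_eq_iff)
  then show "?d + e \<in> lee_ball R" using \<open>d' \<in> lee_ball R\<close> by (simp add: d'_def)
qed

text \<open>Walking back along the offset reaches the center within \<open>R\<close> steps. Both
  directions are recorded because the light cone of a center looks outward and that of any other
  vertex looks inward.\<close>

lemma walk_center:
  assumes "p \<in> V"
  shows "graph_dist (torus_edges L) p (center p) \<le> enat R"
    "graph_dist (torus_edges L) (center p) p \<le> enat R"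
proof -
  let ?d = "offset R (unwrap p)"
  let ?m = "nat \<bar>fst (- ?d)\<bar> + nat \<bar>snd (- ?d)\<bar>"
  have "?m \<le> R" using offset(1)[of R "unwrap p"] by (auto simp: lee_ball_def split_beta)
  then have m: "enat ?m \<le> enat R" by simp
  have w: "(p, center p) \<in> adj_rel (torus_edges L) ^^ ?m"
    using torus_walk[OF L_large(3), of "unwrap p" "- ?d"] assms
    by (simp add: center_def wrap_unwrap)
  show "graph_dist (torus_edges L) p (center p) \<le> enat R"
    using graph_dist_le[OF w] m by (rule order_trans)
  show "graph_dist (torus_edges L) (center p) p \<le> enat R"
    using graph_dist_le[OF adj_rel_relpow_sym[OF w]] m by (rule order_trans)
qed

sublocale clustering V center parity
  by unfold_locales (simp_all add: torus_vertices_def center_in[unfolded torus_vertices_def] center_idem)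

lemma light_cone_ball:
  assumes "v \<in> V"
  shows "light_cone v \<subseteq> graph_ball V (torus_edges L) v R"
proof -
  have "graph_dist (torus_edges L) v v \<le> enat 0" by (rule graph_dist_le) simp
  then have "graph_dist (torus_edges L) v v \<le> enat R" by (rule order_trans) simp
  then show ?thesis using assms walk_center center_in
    by (auto simp: light_cone_def graph_ball_def)
qed

section \<open>Edges as right and upward steps from vertices\<close>

definition right :: "nat \<times> nat \<Rightarrow> nat \<times> nat" where "right = (\<lambda>(a, b). (Suc a mod L, b))"
definition up :: "nat \<times> nat \<Rightarrow> nat \<times> nat" where "up = (\<lambda>(a, b). (a, Suc b mod L))"

lemma right_wrap: "p \<in> V \<Longrightarrow> right p = wrap L (unwrap p + (1, 0))"
  using nat_mod_Suc[OF L_large(3)]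
  by (auto simp: right_def wrap_def unwrap_def torus_vertices_def)

lemma up_wrap: "p \<in> V \<Longrightarrow> up p = wrap L (unwrap p + (0, 1))"
  using nat_mod_Suc[OF L_large(3)]
  by (auto simp: up_def wrap_def unwrap_def torus_vertices_def)

lemma right_in: "p \<in> V \<Longrightarrow> right p \<in> V" and up_in: "p \<in> V \<Longrightarrow> up p \<in> V"
  using L_large by (auto simp: right_def up_def torus_vertices_def)

lemma even_Suc_mod: "even (Suc a mod L) \<longleftrightarrow> odd a"
  using L_even by (simp add: dvd_mod_iff)

lemma parity_step: "parity (right p) \<noteq> parity p" "parity (up p) \<noteq> parity p"
  by (simp_all only: right_def up_def parity_def split_beta fst_conv snd_conv even_add even_Suc_mod) blast+

lemma Suc_mod_neq: "a < L \<Longrightarrow> Suc a mod L \<noteq> a"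
  using L_large by (auto simp: mod_Suc)

text \<open>This rests on \<open>3 \<le> L\<close>: on a cycle of length 2 two steps return to the
  start, and two vertices would share the same outgoing edge.\<close>

lemma Suc_Suc_mod_neq: "a < L \<Longrightarrow> Suc (Suc a mod L) mod L \<noteq> a"
  using L_large by (auto simp: mod_Suc)

lemma torus_edges_eq: "torus_edges L = (\<lambda>p. {p, right p}) ` V \<union> (\<lambda>p. {p, up p}) ` V"
  by (auto simp: torus_edges_def torus_vertices_def right_def up_def image_iff)

lemma inj_right: "inj_on (\<lambda>p. {p, right p}) V"
  by (auto simp: inj_on_def doubleton_eq_iff right_def torus_vertices_def Suc_Suc_mod_neq[symmetric])

lemma inj_up: "inj_on (\<lambda>p. {p, up p}) V"
  by (auto simp: inj_on_def doubleton_eq_iff up_def torus_vertices_def Suc_Suc_mod_neq[symmetric])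

lemma right_neq_up: "p \<in> V \<Longrightarrow> q \<in> V \<Longrightarrow> {p, right p} \<noteq> {q, up q}"
  using Suc_mod_neq by (auto simp: doubleton_eq_iff right_def up_def torus_vertices_def)

text \<open>Each edge is a right step or an upward step, never both, from exactly one vertex, so
  counting edges becomes counting vertices.\<close>

lemma card_edges_where:
  "card {e \<in> torus_edges L. P e} = card {p \<in> V. P {p, right p}} + card {p \<in> V. P {p, up p}}"
proof -
  have "{e \<in> torus_edges L. P e} =
    (\<lambda>p. {p, right p}) ` {p \<in> V. P {p, right p}} \<union> (\<lambda>p. {p, up p}) ` {p \<in> V. P {p, up p}}"
    unfolding torus_edges_eq by blast
  moreover have "card ((\<lambda>p. {p, right p}) ` {p \<in> V. P {p, right p}}) = card {p \<in> V. P {p, right p}}"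
    by (intro card_image inj_on_subset[OF inj_right]) blast
  moreover have "card ((\<lambda>p. {p, up p}) ` {p \<in> V. P {p, up p}}) = card {p \<in> V. P {p, up p}}"
    by (intro card_image inj_on_subset[OF inj_up]) blast
  moreover have "(\<lambda>p. {p, right p}) ` {p \<in> V. P {p, right p}} \<inter> (\<lambda>p. {p, up p}) ` {p \<in> V. P {p, up p}} = {}"
    using right_neq_up by blast
  ultimately show ?thesis using finite_V by (simp add: card_Un_disjoint)
qed

lemma card_V: "card V = L * L"
  by (simp add: torus_vertices_def)

lemma card_edges: "card (torus_edges L) = 2 * (L * L)"
  using card_edges_where[of "\<lambda>_. True"] card_V by simp

text \<open>In each row the offset fixes the first coordinate modulo \<open>lee_size R\<close>,
  which leaves \<open>k\<close> of the \<open>L\<close> positions. The total \<open>L * k\<close> is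
  the number of balls.\<close>

lemma card_offset:
  assumes "d \<in> lee_ball R"
  shows "card {p \<in> V. offset R (unwrap p) = d} = L * k"
proof -
  have iff: "offset R (unwrap (a, b)) = d \<longleftrightarrow>
    int (lee_size R) dvd int a - (syndrome R d - (2 * int R + 1) * int b)" for a b
  proof -
    have "syndrome R (unwrap (a, b)) - syndrome R d = int a - (syndrome R d - (2 * int R + 1) * int b)"
      by (simp add: syndrome_def unwrap_def)
    then show ?thesis using offset(2)[of R "unwrap (a, b)"] offset_unique[OF assms, of "unwrap (a, b)"]
      by metis
  qed
  have "{p \<in> V. offset R (unwrap p) = d} = (\<lambda>(b, a). (a, b)) ` (SIGMA b : {..<L}.
      {a. a < k * lee_size R \<and> int (lee_size R) dvd int a - (syndrome R d - (2 * int R + 1) * int b)})"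
    (is "?A = ?B")
  proof (intro Set.set_eqI)
    fix p :: "nat \<times> nat"
    obtain a b where [simp]: "p = (a, b)" by fastforce
    show "p \<in> ?A \<longleftrightarrow> p \<in> ?B" by (auto simp add: iff torus_vertices_def L_def image_iff)
  qed
  moreover have "inj_on (\<lambda>(b, a). (a, b)) X" for X :: "(nat \<times> nat) set"
    by (auto simp: inj_on_def)
  ultimately show ?thesis
    by (simp add: card_image card_SigmaI card_dvd_class[OF lee_size_pos])
qed

text \<open>The map \<open>f\<close> lists without repetition the 2 R + 1 ball points from which the
  step \<open>e\<close> leaves the ball; \<open>card_offset\<close> counts the vertices at
  each.\<close>

lemma card_boundary:
  assumes inj: "inj_on f {- int R..int R}" and f: "f ` {- int R..int R} \<subseteq> lee_ball R"
    and e: "\<And>d. d \<in> lee_ball R \<Longrightarrow> d + e \<notin> lee_ball R \<longleftrightarrow> d \<in> f ` {- int R..int R}"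
  shows "card {p \<in> V. offset R (unwrap p) + e \<notin> lee_ball R} = (2 * R + 1) * (L * k)"
proof -
  have "{p \<in> V. offset R (unwrap p) + e \<notin> lee_ball R} =
    (\<Union>i\<in>{- int R..int R}. {p \<in> V. offset R (unwrap p) = f i})"
    using e[OF offset(1)] by auto
  also have "card \<dots> = (\<Sum>i\<in>{- int R..int R}. card {p \<in> V. offset R (unwrap p) = f i})"
    using inj finite_V by (intro card_UN_disjoint) (auto simp del: atLeastAtMost_iff dest: inj_onD)
  also have "\<dots> = (\<Sum>i\<in>{- int R..int R}. L * k)"
    using f by (intro sum.cong refl card_offset) auto
  also have "\<dots> = (2 * R + 1) * (L * k)" by (simp add: nat_add_distrib nat_mult_distrib)
  finally show ?thesis .
qed

lemma card_boundary_right: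
  "card {p \<in> V. offset R (unwrap p) + (1, 0) \<notin> lee_ball R} = (2 * R + 1) * (L * k)"
\<comment> \<open>The rightmost point of each row of the ball.\<close>
proof (rule card_boundary[of "\<lambda>y. (int R - \<bar>y\<bar>, y)"])
  show "d + (1, 0) \<notin> lee_ball R \<longleftrightarrow> d \<in> (\<lambda>y. (int R - \<bar>y\<bar>, y)) ` {- int R..int R}"
    if "d \<in> lee_ball R" for d
    using that by (cases d) (auto simp: lee_ball_def image_iff)
qed (auto simp: inj_on_def lee_ball_def)

lemma card_boundary_up:
  "card {p \<in> V. offset R (unwrap p) + (0, 1) \<notin> lee_ball R} = (2 * R + 1) * (L * k)"
proof (rule card_boundary[of "\<lambda>x. (x, int R - \<bar>x\<bar>)"])
  show "d + (0, 1) \<notin> lee_ball R \<longleftrightarrow> d \<in> (\<lambda>x. (x, int R - \<bar>x\<bar>)) ` {- int R..int R}"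
    if "d \<in> lee_ball R" for d
    using that by (cases d) (auto simp: lee_ball_def image_iff)
qed (auto simp: inj_on_def lee_ball_def)

lemma card_cross:
  "card {e \<in> torus_edges L. \<not> is_singleton (center ` e)} = 2 * ((2 * R + 1) * (L * k))"
proof -
  have sing: "is_singleton (center ` {p, q}) \<longleftrightarrow> center q = center p" for p q
    by (auto simp: is_singleton_def)
  have "{p \<in> V. \<not> is_singleton (center ` {p, right p})} =
      {p \<in> V. offset R (unwrap p) + (1, 0) \<notin> lee_ball R}"
    unfolding sing using center_step[of _ "(1, 0)"] right_wrap by auto
  moreover have "{p \<in> V. \<not> is_singleton (center ` {p, up p})} =
      {p \<in> V. offset R (unwrap p) + (0, 1) \<notin> lee_ball R}"
    unfolding sing using center_step[of _ "(0, 1)"] up_wrap by auto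
  ultimately show ?thesis
    unfolding card_edges_where card_boundary_right[symmetric] by (simp add: card_boundary_right card_boundary_up)
qed

lemma cat_prepared: "z2_range_prepared V (torus_edges L) R (state_of V cat_state)"
  unfolding z2_range_prepared_def
  using circ_unitary circ_symmetric circ_has_range[OF light_cone_ball] plus_product plus_symmetric
    circ_plus[symmetric] by blast

lemma cat_energy:
  "expectation_value (state_of V cat_state) (maxcut_hamiltonian V (torus_edges L)) =
    complex_of_real (2 * real (L * L) - real ((2 * R + 1) * (L * k)))"
proof -
  have "expectation_value (state_of V cat_state) (maxcut_hamiltonian V (torus_edges L)) =
    of_nat (card (torus_edges L)) - of_nat (card {e \<in> torus_edges L. \<not> is_singleton (center ` e)}) / 2"
  proof (rule expectation_cat)
    show "finite (torus_edges L)" using finite_V by (simp add: torus_edges_eq)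
    fix e assume "e \<in> torus_edges L"
    then show "\<exists>u\<in>V. \<exists>v\<in>V. e = {u, v} \<and> parity u \<noteq> parity v"
      unfolding torus_edges_eq using right_in up_in parity_step by blast
  qed
  moreover have half: "complex_of_nat (2 * m) / 2 = of_nat m" for m by simp
  ultimately show ?thesis unfolding card_edges card_cross half by simp
qed

end

theorem proposition39:
  fixes R k L n :: nat
  assumes "R \<ge> 1" and "k \<ge> 2" and "even k"
    and "L = k * (2 * R\<^sup>2 + 2 * R + 1)"
    and "n = k\<^sup>2 * (2 * R\<^sup>2 + 2 * R + 1)\<^sup>2"
  shows "\<exists>\<psi>. z2_range_prepared (torus_vertices L) (torus_edges L) R \<psi> \<and>
    expectation_value \<psi> (maxcut_hamiltonian (torus_vertices L) (torus_edges L)) =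
      complex_of_real (2 * real n - (2 * real R + 1) / (2 * (real R)\<^sup>2 + 2 * real R + 1) * real n)"
proof -
  interpret lee_torus R k L
    by unfold_locales (use assms in \<open>simp_all add: lee_size_def\<close>)
  let ?s = "2 * (real R)\<^sup>2 + 2 * real R + 1"
  have "?s > 0" by (simp add: add_nonneg_pos)
  have L: "real L = real k * ?s" unfolding assms(4) by (simp add: algebra_simps)
  have "n = L * L" unfolding assms(4,5) power2_eq_square by (simp only: mult_ac)
  then have n: "real n = real k * ?s * (real k * ?s)" using L by simp
  \<comment> \<open>Dividing \<open>n\<close> by the ball size \<open>?s\<close> gives the number of
    balls, k * ?s * k, which is the \<open>L * k\<close> in \<open>cat_energy\<close>.\<close>
  have "(2 * real R + 1) / ?s * real n = (2 * real R + 1) * (real k * ?s * real k)"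
    unfolding n using \<open>?s > 0\<close> by (simp add: divide_eq_eq)
  then have "2 * real (L * L) - real ((2 * R + 1) * (L * k)) = 2 * real n - (2 * real R + 1) / ?s * real n"
    unfolding of_nat_mult L by (simp add: n)
  then show ?thesis using cat_prepared cat_energy by metis
qed

end
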